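(* Let $n\ge 3$ and consider the affine Weyl group $W_{\mathrm{aff}}$ of type $A_{n-1}^{(1)}$. Let $\alpha\in\Pi_{\mathrm{aff}}^{\mathrm{re},+}$ be such that $\alpha<c$. Then $\Gamma_\alpha(id)=\{s_\alpha\}$.
   Context: Roots. Let $n\ge 3$. Let $\alpha_0,\dots,\alpha_{n-1}$ (indices mod $n$) be the affine simple roots of type $A_{n-1}^{(1)}$, $Q_{\mathrm{aff}}=\bigoplus_{i=0}^{n-1}\mathbb Z\alpha_i$, with symmetric form $\langle\alpha_i,\alpha_i\rangle=2$, $\langle\alpha_i,\alpha_{i\pm1}\rangle=-1$, all other $\langle\alpha_i,\alpha_j\rangle=0$. For $a,b\in Q_{\mathrm{aff}}$, $a\le b$ means $b-a$ has non-negative coefficients, and $a<b$ means $a\le b$, $a\ne b$. Put $c=\sum_{i=0}^{n-1}\alpha_i$ (identified with the imaginary root $\delta$). Let $\Pi=\Pi^+\sqcup\Pi^-$ be the finite root system of type $A_{n-1}$ with simple roots $\alpha_1,\dots,\alpha_{n-1}$. The affine real roots are $\alpha+mc$ with $\alpha\in\Pi$, $m\in\mathbb Z$; such a root is positive if $m>0$, or $m=0$ and $\alpha\in\Pi^+$. The set of positive real roots is $\Pi_{\mathrm{aff}}^{\mathrm{re},+}$. Weyl group. For a real root $\alpha$, $s_\alpha(\mu)=\mu-\langle\mu,\alpha\rangle\alpha$. $W_{\mathrm{aff}}$ is the group generated by $s_i=s_{\alpha_i}$, $0\le i\le n-1$ (a Coxeter group with these generators), with length $\ell$ and Bruhat order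 $\le$. Curve neighborhoods. The moment graph has vertex set $W_{\mathrm{aff}}$ and an edge $u\stackrel{\alpha}{\longrightarrow}us_\alpha$ of degree $\alpha$ for each $u\in W_{\mathrm{aff}}$, $\alpha\in\Pi_{\mathrm{aff}}^{\mathrm{re},+}$. The degree of a chain (a succession of adjacent edges, possibly empty) is the sum of the degrees of its edges. A degree is a tuple $\mathbf d=(d_0,\dots,d_{n-1})\in\mathbb Z_{\ge0}^n$, identified with $\sum d_i\alpha_i$; degrees are ordered componentwise. For $u\in W_{\mathrm{aff}}$, $\Gamma_{\mathbf d}(u)$ is the set of Bruhat-maximal elements of the set of all $v\in W_{\mathrm{aff}}$ that can be joined to some $u'\le u$ by a chain of degree $\le\mathbf d$. *)

theory Defs
  imports
    "HOL-Library.Function_Algebras"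
    "HOL-Algebra.Bij"
    "HOL-Algebra.Generated_Groups"
begin

section \<open>Coxeter-theoretic notions for a group with a generating set\<close>

definition word_length :: "('a, 'b) monoid_scheme \<Rightarrow> 'a set \<Rightarrow> 'a \<Rightarrow> nat"
  where "word_length G S w =
    (LEAST k. \<exists>xs. set xs \<subseteq> S \<and> length xs = k \<and> w = foldr (mult G) xs \<one>\<^bsub>G\<^esub>)"

definition reflections :: "('a, 'b) monoid_scheme \<Rightarrow> 'a set \<Rightarrow> 'a set"
  where "reflections G S = {x \<otimes>\<^bsub>G\<^esub> s \<otimes>\<^bsub>G\<^esub> inv\<^bsub>G\<^esub> x | x s. x \<in> carrier G \<and> s \<in> S}"

definition bruhat_step :: "('a, 'b) monoid_scheme \<Rightarrow> 'a set \<Rightarrow> 'a \<Rightarrow> 'a \<Rightarrow> bool"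
  where "bruhat_step G S u v \<longleftrightarrow> u \<in> carrier G \<and> v \<in> carrier G \<and>
    (\<exists>t \<in> reflections G S. v = u \<otimes>\<^bsub>G\<^esub> t) \<and> word_length G S u < word_length G S v"

definition bruhat_le :: "('a, 'b) monoid_scheme \<Rightarrow> 'a set \<Rightarrow> 'a \<Rightarrow> 'a \<Rightarrow> bool"
  where "bruhat_le G S u v \<longleftrightarrow> u \<in> carrier G \<and> v \<in> carrier G \<and> (bruhat_step G S)\<^sup>*\<^sup>* u v"


section \<open>The affine root system of type A\<close>

text \<open>
  The element with coefficients \<open>a i\<close> on the affine simple roots (\<open>i < n\<close>) is encoded as the
  function \<open>a\<close>, extended by zero. On these functions \<open>+\<close>, \<open>-\<close>, \<open>\<le>\<close> are pointwise, so
  \<open>\<le>\<close> is the order of the root lattice and \<open><\<close> means \<open>\<le>\<close> and \<open>\<noteq>\<close>.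
\<close>

definition Q_aff :: "nat \<Rightarrow> (nat \<Rightarrow> int) set"
  where "Q_aff n = {a. \<forall>i\<ge>n. a i = 0}"

definition simple_root :: "nat \<Rightarrow> nat \<Rightarrow> int"
  where "simple_root i = (\<lambda>k. if k = i then 1 else 0)"

text \<open>The affine Cartan matrix; the indices \<open>i, j < n\<close> are read modulo \<open>n\<close>, and \<open>n \<ge> 3\<close>.\<close>

definition cartan :: "nat \<Rightarrow> nat \<Rightarrow> nat \<Rightarrow> int"
  where "cartan n i j =
    (if i = j then 2
     else if (i + 1) mod n = j \<or> (j + 1) mod n = i then -1
     else 0)"

definition form :: "nat \<Rightarrow> (nat \<Rightarrow> int) \<Rightarrow> (nat \<Rightarrow> int) \<Rightarrow> int"
  where "form n a b = (\<Sum>i<n. \<Sum>j<n. a i * b j * cartan n i j)"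

definition c_aff :: "nat \<Rightarrow> nat \<Rightarrow> int"
  where "c_aff n = (\<Sum>i<n. simple_root i)"

text \<open>
  The positive roots of the finite root system with simple roots \<open>simple_root 1\<close>, \<open>\<dots>\<close>,
  \<open>simple_root (n - 1)\<close> are the sums over nonempty intervals.
\<close>

definition fin_pos_roots :: "nat \<Rightarrow> (nat \<Rightarrow> int) set"
  where "fin_pos_roots n = {\<Sum>k=i..j. simple_root k | i j. 1 \<le> i \<and> i \<le> j \<and> j < n}"

definition fin_roots :: "nat \<Rightarrow> (nat \<Rightarrow> int) set"
  where "fin_roots n = fin_pos_roots n \<union> uminus ` fin_pos_roots n"

definition pos_real_roots :: "nat \<Rightarrow> (nat \<Rightarrow> int) set"
  where "pos_real_roots n =
    {a + (\<lambda>i. m * c_aff n i) | a (m :: int). a \<in> fin_roots n \<and> (m > 0 \<or> m = 0 \<and> a \<in> fin_pos_roots n)}"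


section \<open>The affine Weyl group\<close>

definition root_refl :: "nat \<Rightarrow> (nat \<Rightarrow> int) \<Rightarrow> (nat \<Rightarrow> int) \<Rightarrow> (nat \<Rightarrow> int)"
  where "root_refl n a = (\<lambda>\<mu>\<in>Q_aff n. \<mu> - (\<lambda>i. form n \<mu> a * a i))"

definition simple_refls :: "nat \<Rightarrow> ((nat \<Rightarrow> int) \<Rightarrow> (nat \<Rightarrow> int)) set"
  where "simple_refls n = {root_refl n (simple_root i) | i. i < n}"

text \<open>
  The product is composition of maps, as in \<^const>\<open>BijGroup\<close>. The action on the
  root lattice is faithful, so this is the affine Weyl group itself.
\<close>

definition W_aff :: "nat \<Rightarrow> ((nat \<Rightarrow> int) \<Rightarrow> (nat \<Rightarrow> int)) monoid"
  where "W_aff n = (BijGroup (Q_aff n))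
    \<lparr>carrier := generate (BijGroup (Q_aff n)) (simple_refls n)\<rparr>"

abbreviation W_le :: "nat \<Rightarrow> ((nat \<Rightarrow> int) \<Rightarrow> (nat \<Rightarrow> int)) \<Rightarrow> ((nat \<Rightarrow> int) \<Rightarrow> (nat \<Rightarrow> int)) \<Rightarrow> bool"
  where "W_le n \<equiv> bruhat_le (W_aff n) (simple_refls n)"


section \<open>Curve neighborhoods\<close>

text \<open>\<open>mg_chain n u v d\<close>: some chain of degree \<open>d\<close> in the moment graph leads from \<open>u\<close> to \<open>v\<close>.\<close>

inductive mg_chain ::
  "nat \<Rightarrow> ((nat \<Rightarrow> int) \<Rightarrow> (nat \<Rightarrow> int)) \<Rightarrow> ((nat \<Rightarrow> int) \<Rightarrow> (nat \<Rightarrow> int)) \<Rightarrow> (nat \<Rightarrow> int) \<Rightarrow> bool"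
  for n u where
  empty: "u \<in> carrier (W_aff n) \<Longrightarrow> mg_chain n u u 0"
| step: "mg_chain n u v d \<Longrightarrow> a \<in> pos_real_roots n \<Longrightarrow>
    mg_chain n u (v \<otimes>\<^bsub>W_aff n\<^esub> root_refl n a) (d + a)"

definition reachable ::
  "nat \<Rightarrow> (nat \<Rightarrow> int) \<Rightarrow> ((nat \<Rightarrow> int) \<Rightarrow> (nat \<Rightarrow> int)) \<Rightarrow> ((nat \<Rightarrow> int) \<Rightarrow> (nat \<Rightarrow> int)) set"
  where "reachable n d u =
    {v \<in> carrier (W_aff n). \<exists>u' d'. W_le n u' u \<and> mg_chain n u' v d' \<and> d' \<le> d}"

text \<open>The maximal elements; the degree \<open>d\<close> is meant to lie in \<open>Q_aff n\<close> with \<open>0 \<le> d\<close>.\<close>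

definition curve_nbhd ::
  "nat \<Rightarrow> (nat \<Rightarrow> int) \<Rightarrow> ((nat \<Rightarrow> int) \<Rightarrow> (nat \<Rightarrow> int)) \<Rightarrow> ((nat \<Rightarrow> int) \<Rightarrow> (nat \<Rightarrow> int)) set"
  where "curve_nbhd n d u =
    {v \<in> reachable n d u. \<forall>w \<in> reachable n d u. W_le n v w \<longrightarrow> w = v}"

end

theory Submission
  imports Defs
begin

text \<open>
  Since \<open>\<langle>a, a\<rangle>\<close> is the sum of the squared cyclic differences of the coefficients of \<open>a\<close>, the real
  roots are the lattice vectors of norm 2, the form is positive semidefinite with radical spanned
  by \<open>c\<close>, and every real root is positive or negative. The exchange argument then gives
  \<open>w < w s\<^sub>b\<close> whenever \<open>b\<close> and \<open>w b\<close> are positive.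

  A chain from \<open>id\<close> of degree at most \<open>\<alpha> < c\<close> is a product of reflections in positive roots with
  pairwise disjoint supports. Appending simple reflections increases this product until the roots
  sum to \<open>\<alpha>\<close>. If then more than one root is left, the last root \<open>g\<close> is not orthogonal to all the
  others: otherwise \<open>\<alpha> - g\<close> would be isotropic, hence \<open>0\<close>. Taking the last \<open>b\<close> not orthogonal to
  \<open>g\<close>, one has \<open>\<langle>b, g\<rangle> = -1\<close>, and replacing \<open>b\<close> by the root \<open>b + g\<close> and dropping \<open>g\<close> increases
  the product again. This ends with \<open>s\<^sub>\<alpha>\<close>.
\<close>

locale affine_type_A =
  fixes n :: nat
  assumes n_ge_3: "n \<ge> 3"
begin

section \<open>The form as a sum over cyclic differences\<close>

definition diff :: "(nat \<Rightarrow> int) \<Rightarrow> nat \<Rightarrow> int"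
  where "diff a i = a i - a (Suc i mod n)"

lemma bij_betw_Suc_mod: "bij_betw (\<lambda>i. Suc i mod n) {..<n} {..<n}"
proof -
  have "inj_on (\<lambda>i. Suc i mod n) {..<n}"
  proof (rule inj_onI)
    fix i j assume "i \<in> {..<n}" "j \<in> {..<n}" "Suc i mod n = Suc j mod n"
    then show "i = j"
      by (cases "Suc i = n"; cases "Suc j = n") (auto simp: Suc_lessI)
  qed
  moreover have "(\<lambda>i. Suc i mod n) ` {..<n} \<subseteq> {..<n}"
    using n_ge_3 by auto
  ultimately show ?thesis
    by (simp add: bij_betw_def endo_inj_surj)
qed

lemma sum_Suc_mod: "(\<Sum>i<n. f (Suc i mod n)) = (\<Sum>i<n. f i)"
  by (rule sum.reindex_bij_betw[OF bij_betw_Suc_mod])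

text \<open>Since \<open>n \<ge> 3\<close>, an index differs from its successor and its two
  neighbours differ from each other, so the three indicators never overlap. In this additive shape
  the double sum defining \<open>form\<close> collapses.\<close>

lemma cartan_eq:
  assumes "i < n" "j < n"
  shows "cartan n i j =
    (if j = i then 2 else 0) - (if j = Suc i mod n then 1 else 0) - (if i = Suc j mod n then 1 else 0)"
proof -
  have "i \<noteq> Suc i mod n" if "i < n" for i
    using that n_ge_3 by (cases "Suc i = n") (auto simp: Suc_lessI)
  moreover have "\<not> (j = Suc i mod n \<and> i = Suc j mod n)"
    using assms n_ge_3
    by (cases "Suc i = n"; cases "Suc j = n") (auto simp: Suc_lessI)
  ultimately show ?thesis
    using assms by (auto simp: cartan_def)
qed

lemma form_eq:
  "form n a b = 2 * (\<Sum>i<n. a i * b i) - (\<Sum>i<n. a i * b (Suc i mod n)) - (\<Sum>i<n. a (Suc i mod n) * b i)"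
proof -
  have m: "Suc i mod n < n" for i
    using n_ge_3 by simp
  have "form n a b = (\<Sum>i<n. \<Sum>j<n. 2 * (if j = i then a i * b j else 0)
      - (if j = Suc i mod n then a i * b j else 0) - (if i = Suc j mod n then a i * b j else 0))"
    unfolding form_def by (intro sum.cong refl) (auto simp: cartan_eq)
  also have "\<dots> = 2 * (\<Sum>i<n. \<Sum>j<n. if j = i then a i * b j else 0)
      - (\<Sum>i<n. \<Sum>j<n. if j = Suc i mod n then a i * b j else 0)
      - (\<Sum>i<n. \<Sum>j<n. if i = Suc j mod n then a i * b j else 0)"
    by (simp only: sum_subtractf sum_distrib_left)
  also have "(\<Sum>i<n. \<Sum>j<n. if i = Suc j mod n then a i * b j else 0)
      = (\<Sum>j<n. \<Sum>i<n. if i = Suc j mod n then a i * b j else 0)"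
    by (rule sum.swap)
  finally show ?thesis
    using m by simp
qed

text \<open>In the expanded product the diagonal occurs twice, once shifted, and the shift permutes
  the indices. Bilinearity, symmetry and semidefiniteness can be read off from this shape.\<close>

lemma form_diff: "form n a b = (\<Sum>i<n. diff a i * diff b i)"
proof -
  have "(\<Sum>i<n. diff a i * diff b i) = (\<Sum>i<n. a i * b i) - (\<Sum>i<n. a i * b (Suc i mod n))
      - (\<Sum>i<n. a (Suc i mod n) * b i) + (\<Sum>i<n. a (Suc i mod n) * b (Suc i mod n))"
    by (simp add: diff_def algebra_simps sum.distrib sum_subtractf)
  moreover have "(\<Sum>i<n. a (Suc i mod n) * b (Suc i mod n)) = (\<Sum>i<n. a i * b i)"
    by (rule sum_Suc_mod)
  ultimately show ?thesis
    by (simp add: form_eq)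
qed

lemma form_commute: "form n a b = form n b a"
  by (simp add: form_diff mult.commute)

lemma form_add_left: "form n (a + b) x = form n a x + form n b x"
  by (simp add: form_diff diff_def algebra_simps sum.distrib sum_subtractf)

lemma form_add_right: "form n x (a + b) = form n x a + form n x b"
  using form_add_left form_commute by metis

lemma form_scale_left: "form n (\<lambda>i. k * a i) x = k * form n a x"
  by (simp add: form_diff diff_def algebra_simps sum_distrib_left)

lemma form_scale_right: "form n x (\<lambda>i. k * a i) = k * form n x a"
  using form_scale_left form_commute by metis

lemma form_uminus_left: "form n (- a) x = - form n a x"
  by (simp add: form_diff diff_def algebra_simps sum.distrib sum_subtractf)

lemma form_zero_left [simp]: "form n 0 x = 0"
  by (simp add: form_diff diff_def)

lemma form_self_nonneg: "form n a a \<ge> 0"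
  by (simp add: form_diff sum_nonneg)

text \<open>A vanishing sum of squares has vanishing terms, so consecutive coefficients agree: on
  the indices below \<open>n\<close>, isotropic vectors are multiples of \<open>c\<close>.\<close>

lemma form_self_zero_const:
  assumes "form n a a = 0" "i < n"
  shows "a i = a 0"
proof -
  have z: "\<forall>j\<in>{..<n}. diff a j * diff a j = 0"
    using assms(1) sum_nonneg_eq_0_iff[of "{..<n}" "\<lambda>j. diff a j * diff a j"]
    by (simp add: form_diff)
  show ?thesis
    using assms(2)
  proof (induction i)
    case (Suc i)
    then have "diff a i = 0" using z by simp
    then show ?case using Suc by (simp add: diff_def)
  qed simp
qed

text \<open>With disjoint supports the diagonal terms of \<open>form_eq\<close> vanish and only the
  neighbour terms, which carry a minus sign, remain.\<close>

lemma form_nonpos_disjoint: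
  assumes "0 \<le> a" "0 \<le> b" "\<And>i. a i * b i = 0"
  shows "form n a b \<le> 0"
proof -
  have "a i * b j \<ge> 0" for i j
    using assms(1,2) by (simp add: le_fun_def)
  then have "(\<Sum>i<n. a i * b (Suc i mod n)) \<ge> 0" "(\<Sum>i<n. a (Suc i mod n) * b i) \<ge> 0"
    by (simp_all add: sum_nonneg)
  moreover have "(\<Sum>i<n. a i * b i) = 0"
    using assms(3) by (simp only: sum.neutral_const)
  ultimately show ?thesis
    by (simp add: form_eq)
qed

section \<open>Roots as lattice vectors of norm 2, and their signs\<close>

definition roots :: "(nat \<Rightarrow> int) set"
  where "roots = {a \<in> Q_aff n. form n a a = 2}"

definition pos_roots :: "(nat \<Rightarrow> int) set"
  where "pos_roots = {a \<in> roots. 0 \<le> a}"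

lemma root_in_Q: "a \<in> roots \<Longrightarrow> a \<in> Q_aff n"
  by (simp add: roots_def)

lemma pos_root_root: "a \<in> pos_roots \<Longrightarrow> a \<in> roots"
  by (simp add: pos_roots_def)

lemma pos_root_in_Q: "a \<in> pos_roots \<Longrightarrow> a \<in> Q_aff n"
  by (simp add: pos_roots_def roots_def)

text \<open>
  Around the cycle, \<open>a\<close> has to descend by at least 2 and to climb back, so the sum of the
  squared differences is at least 4.
\<close>

lemma form_ge_4:
  assumes "p < q" "q < n" "a p - a q \<ge> 2 \<or> a q - a p \<ge> 2"
  shows "form n a a \<ge> 4"
proof -
  let ?I = "{p..<q}" and ?J = "{..<n} - {p..<q}"
  have *: "\<bar>\<Sum>i\<in>A. diff a i\<bar> \<le> (\<Sum>i\<in>A. diff a i * diff a i)" for A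
  proof -
    have "\<bar>x\<bar> \<le> x * x" for x :: int
      using self_le_power[of "\<bar>x\<bar>" 2] by (cases "x = 0") (auto simp: power2_eq_square)
    then have "(\<Sum>i\<in>A. \<bar>diff a i\<bar>) \<le> (\<Sum>i\<in>A. diff a i * diff a i)"
      by (rule sum_mono)
    then show ?thesis
      using sum_abs[of "diff a" A] by linarith
  qed
  have split: "sum f {..<n} = sum f ?I + sum f ?J" for f :: "nat \<Rightarrow> int"
    using sum.subset_diff[of ?I "{..<n}" f] assms by (force simp: add.commute)
  have "(\<Sum>i\<in>?I. diff a i) = (\<Sum>i\<in>?I. a i - a (Suc i))"
    using assms by (intro sum.cong) (auto simp: diff_def)
  also have "\<dots> = a p - a q"
    using sum_Suc_diff'[of p q "\<lambda>i. - a i"] assms by simp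
  finally have I: "(\<Sum>i\<in>?I. diff a i) = a p - a q" .
  have "(\<Sum>i<n. diff a i) = 0"
    by (simp add: diff_def sum_subtractf sum_Suc_mod)
  then have J: "(\<Sum>i\<in>?J. diff a i) = a q - a p"
    using split[of "diff a"] I by simp
  show ?thesis
    unfolding form_diff
    using split[of "\<lambda>i. diff a i * diff a i"] *[of ?I] *[of ?J] I J assms(3)
    by linarith
qed

text \<open>A negative coefficient beside the positive one would make a gap of at least 2 and so a
  norm of at least 4. Later positivity proofs for images of roots under group elements reduce to
  this test.\<close>

lemma root_pos_coeff:
  assumes "a \<in> roots" "a p > 0"
  shows "a \<in> pos_roots"
proof -
  have "a q \<ge> 0" for q
  proof (rule ccontr)
    assume q: "\<not> a q \<ge> 0"
    have "p < n" "q < n"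
      using assms q by (force simp: roots_def Q_aff_def not_less[symmetric])+
    moreover have "p \<noteq> q" using q assms by auto
    ultimately have "form n a a \<ge> 4"
      using form_ge_4[of p q a] form_ge_4[of q p a] q assms(2) by linarith
    then show False using assms by (simp add: roots_def)
  qed
  then show ?thesis using assms by (simp add: pos_roots_def le_fun_def)
qed

lemma pos_root_ex_pos:
  assumes "a \<in> pos_roots"
  obtains p where "p < n" "a p > 0"
proof -
  have "\<exists>p. a p \<noteq> 0"
  proof (rule ccontr)
    assume "\<not> ?thesis"
    then have "a = 0" by auto
    then show False using assms by (simp add: pos_roots_def roots_def)
  qed
  then obtain p where "a p \<noteq> 0" by blast
  moreover have "p < n"
    using assms \<open>a p \<noteq> 0\<close> by (auto simp: pos_roots_def roots_def Q_aff_def not_less[symmetric])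
  moreover have "a p \<ge> 0"
    using assms by (auto simp: pos_roots_def le_fun_def)
  ultimately show ?thesis using that[of p] by simp
qed

lemma uminus_pos_root:
  assumes "a \<in> pos_roots"
  shows "- a \<notin> pos_roots"
proof
  assume a: "- a \<in> pos_roots"
  obtain p where "a p > 0"
    using pos_root_ex_pos[OF assms] by blast
  moreover have "- a p \<ge> 0"
    using a by (simp add: pos_roots_def le_fun_def)
  ultimately show False by simp
qed

lemma simple_root_pos:
  assumes "i < n"
  shows "simple_root i \<in> pos_roots"
proof -
  have "Suc i mod n \<noteq> i" "Suc i mod n < n"
    using assms n_ge_3 by (cases "Suc i = n", auto simp: Suc_lessI)
  then have "form n (simple_root i) (simple_root i) = 2"
    using assms by (simp add: form_eq simple_root_def if_distrib if_distribR sum.If_cases cong: if_cong)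
  then show ?thesis using assms
    by (auto simp: pos_roots_def roots_def Q_aff_def simple_root_def le_fun_def)
qed

section \<open>Reflections as linear isometries of the lattice\<close>

lemma Q_add: "x \<in> Q_aff n \<Longrightarrow> y \<in> Q_aff n \<Longrightarrow> x + y \<in> Q_aff n"
  by (simp add: Q_aff_def)

lemma Q_add_scale: "x \<in> Q_aff n \<Longrightarrow> y \<in> Q_aff n \<Longrightarrow> x + (\<lambda>i. k * y i) \<in> Q_aff n"
  by (simp add: Q_aff_def)

lemma root_refl_apply:
  "x \<in> Q_aff n \<Longrightarrow> root_refl n b x = x + (\<lambda>i. (- form n x b) * b i)"
  by (simp add: root_refl_def fun_eq_iff)

lemma root_refl_in_Q: "x \<in> Q_aff n \<Longrightarrow> b \<in> roots \<Longrightarrow> root_refl n b x \<in> Q_aff n"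
  using Q_add_scale[OF _ root_in_Q] by (simp only: root_refl_apply)

lemma root_refl_self: "b \<in> roots \<Longrightarrow> root_refl n b b = - b"
  by (simp add: root_refl_apply root_in_Q fun_eq_iff) (simp add: roots_def)

lemma root_refl_invol:
  assumes "b \<in> roots" "x \<in> Q_aff n"
  shows "root_refl n b (root_refl n b x) = x"
proof -
  have "form n b b = 2" using assms by (simp add: roots_def)
  moreover have "form n (root_refl n b x) b = form n x b + (- form n x b) * form n b b"
    by (simp only: root_refl_apply[OF assms(2)] form_add_left form_scale_left)
  ultimately have "form n (root_refl n b x) b = - form n x b"
    by simp
  then have "root_refl n b (root_refl n b x) = root_refl n b x + (\<lambda>i. form n x b * b i)"
    using root_refl_apply[OF root_refl_in_Q[OF assms(2,1)], of b] by simp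
  then show ?thesis
    by (simp add: root_refl_apply[OF assms(2)] fun_eq_iff)
qed

text \<open>The one identity covers additivity and homogeneity at once, and it keeps to arguments in
  the lattice, since group elements carry no information elsewhere.\<close>

definition lin_isometry :: "((nat \<Rightarrow> int) \<Rightarrow> (nat \<Rightarrow> int)) \<Rightarrow> bool"
  where "lin_isometry g \<longleftrightarrow> g \<in> Bij (Q_aff n) \<and>
    (\<forall>x\<in>Q_aff n. \<forall>y\<in>Q_aff n. (\<forall>k. g (x + (\<lambda>i. k * y i)) = g x + (\<lambda>i. k * g y i)) \<and>
      form n (g x) (g y) = form n x y)"

lemma root_refl_Bij:
  assumes "b \<in> roots"
  shows "root_refl n b \<in> Bij (Q_aff n)"
proof -
  have "bij_betw (root_refl n b) (Q_aff n) (Q_aff n)"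
    by (rule bij_betw_byWitness[where f' = "root_refl n b"])
      (auto simp: assms root_refl_invol root_refl_in_Q)
  then show ?thesis by (simp add: Bij_def root_refl_def)
qed

lemma lin_isometry_root_refl:
  assumes "b \<in> roots"
  shows "lin_isometry (root_refl n b)"
proof -
  have b: "form n b b = 2" using assms by (simp add: roots_def)
  have "form n (root_refl n b x) (root_refl n b y) = form n x y"
    if "x \<in> Q_aff n" "y \<in> Q_aff n" for x y
  proof -
    have "form n (root_refl n b x) (root_refl n b y) = form n x y + (- form n y b) * form n x b
        + (- form n x b) * (form n b y + (- form n y b) * form n b b)"
      unfolding root_refl_apply[OF that(1)] root_refl_apply[OF that(2)]
        form_add_left form_add_right form_scale_left form_scale_right
      by (simp add: algebra_simps)
    then show ?thesis
      unfolding b form_commute[of b y] by (simp add: algebra_simps)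
  qed
  moreover have "root_refl n b (x + (\<lambda>i. k * y i)) = root_refl n b x + (\<lambda>i. k * root_refl n b y i)"
    if "x \<in> Q_aff n" "y \<in> Q_aff n" for x y k
  proof -
    have "form n (x + (\<lambda>i. k * y i)) b = form n x b + k * form n y b"
      by (simp only: form_add_left form_scale_left)
    then show ?thesis
      unfolding root_refl_apply[OF that(1)] root_refl_apply[OF that(2)]
        root_refl_apply[OF Q_add_scale[OF that]]
      by (simp add: fun_eq_iff algebra_simps)
  qed
  ultimately show ?thesis
    using root_refl_Bij[OF assms] by (simp add: lin_isometry_def)
qed

section \<open>The affine Weyl group acting on the lattice\<close>

interpretation B: group "BijGroup (Q_aff n)"
  by (rule group_BijGroup)

lemma simple_refls_eq: "simple_refls n = (\<lambda>i. root_refl n (simple_root i)) ` {..<n}"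
  by (auto simp: simple_refls_def)

lemma simple_refls_Bij: "simple_refls n \<subseteq> carrier (BijGroup (Q_aff n))"
  by (auto simp: simple_refls_eq BijGroup_def root_refl_Bij simple_root_pos pos_root_root)

sublocale W: group "W_aff n"
  unfolding W_aff_def
  by (rule subgroup.subgroup_is_group[OF B.generate_is_subgroup[OF simple_refls_Bij]])
    (rule group_BijGroup)

lemma W_Bij:
  assumes "g \<in> carrier (W_aff n)"
  shows "g \<in> Bij (Q_aff n)"
proof -
  have "g \<in> generate (BijGroup (Q_aff n)) (simple_refls n)"
    using assms by (simp add: W_aff_def)
  then have "g \<in> carrier (BijGroup (Q_aff n))"
    by (rule B.generate_in_carrier[OF simple_refls_Bij])
  then show ?thesis
    by (simp add: BijGroup_def)
qed

lemma W_mult_apply: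
  assumes "g \<in> carrier (W_aff n)" "h \<in> carrier (W_aff n)" "x \<in> Q_aff n"
  shows "(g \<otimes>\<^bsub>W_aff n\<^esub> h) x = g (h x)"
  using W_Bij[OF assms(1)] W_Bij[OF assms(2)] assms(3)
  by (simp add: W_aff_def BijGroup_def compose_def)

lemma W_one_apply: "x \<in> Q_aff n \<Longrightarrow> \<one>\<^bsub>W_aff n\<^esub> x = x"
  by (simp add: W_aff_def BijGroup_def)

lemma W_in_Q:
  assumes "g \<in> carrier (W_aff n)" "x \<in> Q_aff n"
  shows "g x \<in> Q_aff n"
proof -
  have "bij_betw g (Q_aff n) (Q_aff n)"
    using W_Bij[OF assms(1)] by (simp add: Bij_def)
  then show ?thesis
    using assms(2) by (rule bij_betw_apply)
qed

text \<open>Members of \<open>Bij\<close> are extensional, that is, \<open>undefined\<close> off the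
  lattice, so agreement on the lattice is enough. Identities in the group are verified pointwise in
  this way.\<close>

lemma Bij_eqI:
  assumes "g \<in> Bij (Q_aff n)" "h \<in> Bij (Q_aff n)" "\<And>x. x \<in> Q_aff n \<Longrightarrow> g x = h x"
  shows "g = h"
proof (rule extensionalityI)
  show "g \<in> extensional (Q_aff n)" "h \<in> extensional (Q_aff n)"
    using assms by (auto simp: Bij_def)
qed (rule assms(3))

lemma simple_refl_in_W: "t \<in> simple_refls n \<Longrightarrow> t \<in> carrier (W_aff n)"
  by (simp add: W_aff_def generate.incl)

lemma simple_refl_invol:
  assumes "t \<in> simple_refls n"
  shows "t \<otimes>\<^bsub>W_aff n\<^esub> t = \<one>\<^bsub>W_aff n\<^esub>"
proof (rule Bij_eqI)
  show "(t \<otimes>\<^bsub>W_aff n\<^esub> t) x = \<one>\<^bsub>W_aff n\<^esub> x" if "x \<in> Q_aff n" for x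
    using assms that simple_refl_in_W[OF assms]
    by (auto simp: W_mult_apply W_one_apply simple_refls_eq root_refl_invol simple_root_pos pos_root_root)
qed (simp_all add: assms simple_refl_in_W W_Bij)

section \<open>Words in the simple reflections\<close>

abbreviation word_prod :: "((nat \<Rightarrow> int) \<Rightarrow> (nat \<Rightarrow> int)) list \<Rightarrow> (nat \<Rightarrow> int) \<Rightarrow> (nat \<Rightarrow> int)"
  where "word_prod xs \<equiv> foldr (\<otimes>\<^bsub>W_aff n\<^esub>) xs \<one>\<^bsub>W_aff n\<^esub>"

lemma word_prod_in_W: "set xs \<subseteq> simple_refls n \<Longrightarrow> word_prod xs \<in> carrier (W_aff n)"
  by (induction xs) (auto simp: simple_refl_in_W)

lemma word_prod_append:
  "set xs \<subseteq> simple_refls n \<Longrightarrow> set ys \<subseteq> simple_refls n \<Longrightarrow>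
    word_prod (xs @ ys) = word_prod xs \<otimes>\<^bsub>W_aff n\<^esub> word_prod ys"
  by (induction xs) (auto simp: simple_refl_in_W word_prod_in_W W.m_assoc)

lemma W_word:
  assumes "g \<in> carrier (W_aff n)"
  obtains xs where "set xs \<subseteq> simple_refls n" "g = word_prod xs"
proof -
  have "g \<in> generate (BijGroup (Q_aff n)) (simple_refls n)"
    using assms by (simp add: W_aff_def)
  then have "\<exists>xs. set xs \<subseteq> simple_refls n \<and> g = word_prod xs"
  proof induction
    case one
    show ?case by (rule exI[of _ "[]"]) (simp add: W_aff_def)
  next
    case (incl h)
    then show ?case by (intro exI[of _ "[h]"]) (simp add: simple_refl_in_W)
  next
    case (inv h)
    \<comment> \<open>The generated subgroup also takes in inverses of generators; as the generators
      are involutions, these are one-letter words again.\<close>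
    have "inv\<^bsub>BijGroup (Q_aff n)\<^esub> h = h"
    proof (rule B.inv_equality)
      show "h \<otimes>\<^bsub>BijGroup (Q_aff n)\<^esub> h = \<one>\<^bsub>BijGroup (Q_aff n)\<^esub>"
        using simple_refl_invol[OF inv] by (simp add: W_aff_def)
    qed (use inv simple_refls_Bij in auto)
    then show ?case using inv by (intro exI[of _ "[h]"]) (simp add: simple_refl_in_W)
  next
    case (eng h1 h2)
    then obtain xs ys where "set xs \<subseteq> simple_refls n" "h1 = word_prod xs"
      "set ys \<subseteq> simple_refls n" "h2 = word_prod ys" by blast
    then show ?case
      using word_prod_append[of xs ys]
      by (intro exI[of _ "xs @ ys"]) (simp add: W_aff_def)
  qed
  then show ?thesis using that by blast
qed

lemma lin_isometry_W:
  assumes "g \<in> carrier (W_aff n)"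
  shows "lin_isometry g"
proof -
  obtain xs where "set xs \<subseteq> simple_refls n" "g = word_prod xs"
    using W_word[OF assms] .
  moreover have "set xs \<subseteq> simple_refls n \<Longrightarrow> lin_isometry (word_prod xs)"
  proof (induction xs)
    case Nil
    then show ?case
      using W_Bij[OF W.one_closed]
      by (simp add: lin_isometry_def W_one_apply Q_add_scale)
  next
    case (Cons t xs)
    then have t: "lin_isometry t"
      using lin_isometry_root_refl simple_root_pos pos_root_root by (auto simp: simple_refls_eq)
    have W: "t \<in> carrier (W_aff n)" "word_prod xs \<in> carrier (W_aff n)"
      using Cons.prems by (auto simp: simple_refl_in_W word_prod_in_W)
    have IH: "lin_isometry (word_prod xs)"
      using Cons by simp
    have "(t \<otimes>\<^bsub>W_aff n\<^esub> word_prod xs) (x + (\<lambda>i. k * y i)) =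
        (t \<otimes>\<^bsub>W_aff n\<^esub> word_prod xs) x + (\<lambda>i. k * (t \<otimes>\<^bsub>W_aff n\<^esub> word_prod xs) y i)"
      if xy: "x \<in> Q_aff n" "y \<in> Q_aff n" for x y k
    proof -
      have "word_prod xs (x + (\<lambda>i. k * y i)) = word_prod xs x + (\<lambda>i. k * word_prod xs y i)"
        using IH xy by (simp only: lin_isometry_def)
      moreover have "t (word_prod xs x + (\<lambda>i. k * word_prod xs y i)) =
          t (word_prod xs x) + (\<lambda>i. k * t (word_prod xs y) i)"
        using t xy W_in_Q[OF W(2)] by (simp only: lin_isometry_def)
      ultimately show ?thesis
        by (simp only: W_mult_apply[OF W] xy Q_add_scale)
    qed
    moreover have "form n ((t \<otimes>\<^bsub>W_aff n\<^esub> word_prod xs) x) ((t \<otimes>\<^bsub>W_aff n\<^esub> word_prod xs) y) = form n x y"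
      if "x \<in> Q_aff n" "y \<in> Q_aff n" for x y
      using t IH that W_in_Q[OF W(2)] by (simp add: lin_isometry_def W_mult_apply[OF W])
    ultimately show ?case
      using W_Bij[OF W.m_closed[OF W]] by (simp only: lin_isometry_def foldr.simps o_apply) blast
  qed
  ultimately show ?thesis by simp
qed

lemma W_linear:
  assumes "g \<in> carrier (W_aff n)" "x \<in> Q_aff n" "y \<in> Q_aff n"
  shows "g (x + (\<lambda>i. k * y i)) = g x + (\<lambda>i. k * g y i)"
  using lin_isometry_W[OF assms(1)] assms(2,3) unfolding lin_isometry_def by blast

lemma W_uminus:
  assumes "g \<in> carrier (W_aff n)" "x \<in> Q_aff n"
  shows "g (- x) = - g x"
proof -
  \<comment> \<open>Negation is written as adding \<open>- 2\<close> times the vector to itself, so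
    that the linearity identity applies with both vectors equal to \<open>x\<close>.\<close>
  have *: "x + (\<lambda>i. (- 2) * x i) = - x" "g x + (\<lambda>i. (- 2) * g x i) = - g x"
    by (simp_all add: fun_eq_iff)
  then show ?thesis
    using W_linear[OF assms(1) assms(2) assms(2), of "- 2"] by (simp only: *)
qed

lemma W_form:
  assumes "g \<in> carrier (W_aff n)" "x \<in> Q_aff n" "y \<in> Q_aff n"
  shows "form n (g x) (g y) = form n x y"
  using lin_isometry_W[OF assms(1)] assms(2,3) unfolding lin_isometry_def by blast

lemma W_root:
  assumes "g \<in> carrier (W_aff n)" "a \<in> roots"
  shows "g a \<in> roots"
  using assms W_in_Q[of g a] W_form[of g a a] by (simp add: roots_def)

text \<open>This is the rule \<open>g s_b g^-1 = s_(g b)\<close>, evaluated at \<open>g x\<close> so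
  that no inverse occurs; it comes from linearity and from invariance of the form.\<close>

lemma root_refl_conj_apply:
  assumes "g \<in> carrier (W_aff n)" "b \<in> roots" "x \<in> Q_aff n"
  shows "root_refl n (g b) (g x) = g (root_refl n b x)"
  unfolding root_refl_apply[OF assms(3)] root_refl_apply[OF W_in_Q[OF assms(1,3)]]
    W_linear[OF assms(1,3) root_in_Q[OF assms(2)]] W_form[OF assms(1,3) root_in_Q[OF assms(2)]]
  by (rule refl)

lemma root_refl_add:
  assumes "x \<in> Q_aff n" "y \<in> Q_aff n"
  shows "root_refl n b (x + y) = root_refl n b x + root_refl n b y"
  unfolding root_refl_apply[OF assms(1)] root_refl_apply[OF assms(2)]
    root_refl_apply[OF Q_add[OF assms]] form_add_left
  by (simp add: fun_eq_iff algebra_simps)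

text \<open>The reflection changes only the coefficient at \<open>i\<close>. A positive root other
  than \<open>simple_root i\<close> has a positive coefficient elsewhere, which survives and decides
  the sign.\<close>

lemma simple_refl_pos_root:
  assumes "i < n" "b \<in> pos_roots" "b \<noteq> simple_root i"
  shows "root_refl n (simple_root i) b \<in> pos_roots"
proof -
  have b: "b \<in> roots" "b \<in> Q_aff n" "0 \<le> b" "form n b b = 2"
    using assms by (auto simp: pos_roots_def roots_def)
  have i: "form n (simple_root i) (simple_root i) = 2" "simple_root i \<in> roots"
    using simple_root_pos[OF assms(1)] by (auto simp: pos_roots_def roots_def)
  have "\<exists>p. p \<noteq> i \<and> b p \<noteq> 0"
  proof (rule ccontr)
    assume *: "\<not> ?thesis"
    define c where "c = b i"
    have c: "b = (\<lambda>k. c * simple_root i k)"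
      by (rule ext) (use * in \<open>auto simp: simple_root_def c_def\<close>)
    \<comment> \<open>The multiple by \<open>c\<close> of a simple root has norm
      \<open>2 c^2\<close>, so norm 2 and \<open>c \<ge> 0\<close> leave only
      \<open>c = 1\<close>.\<close>
    have "form n b b = c * (c * 2)"
      by (simp only: c form_scale_left form_scale_right i)
    then have "c * c = 1"
      using b(4) by linarith
    moreover have "c \<ge> 0" using b(3) by (simp add: le_fun_def c_def)
    ultimately have "c = 1"
      using pos_zmult_eq_1_iff[of c c] by (cases "c = 0") auto
    then show False using assms(3) c by simp
  qed
  then obtain p where p: "p \<noteq> i" "b p \<noteq> 0" by blast
  have "b p \<ge> 0" using b(3) by (simp add: le_fun_def)
  then have pos: "root_refl n (simple_root i) b p > 0"
    using p by (simp add: root_refl_apply[OF b(2)] simple_root_def)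
  have "root_refl n (simple_root i) b \<in> roots"
    using W_root[OF simple_refl_in_W b(1), of "root_refl n (simple_root i)"] assms(1)
    by (simp add: simple_refls_eq)
  then show ?thesis
    using pos by (rule root_pos_coeff)
qed

section \<open>Root reflections as conjugates of simple reflections\<close>

lemma form_simple_root:
  assumes "i < n"
  shows "form n (simple_root i) b = (\<Sum>j<n. b j * cartan n i j)"
proof -
  have "form n (simple_root i) b = (\<Sum>k<n. if k = i then (\<Sum>j<n. b j * cartan n i j) else 0)"
    unfolding form_def by (intro sum.cong) (auto simp: simple_root_def)
  then show ?thesis using assms by simp
qed

lemma form_simple_root_expand: "form n b b = (\<Sum>i<n. b i * form n b (simple_root i))"
proof -
  have "form n b b = (\<Sum>i<n. b i * (\<Sum>j<n. b j * cartan n i j))"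
    by (simp add: form_def sum_distrib_left mult.assoc)
  also have "\<dots> = (\<Sum>i<n. b i * form n b (simple_root i))"
    by (intro sum.cong refl) (simp only: form_simple_root lessThan_iff form_commute[of b])
  finally show ?thesis .
qed

text \<open>Induction on the height, the sum of the coefficients: reflecting a non-simple positive
  root in a suitable simple root gives a positive root of smaller height, and conjugating its
  reflection back yields the one sought.\<close>

lemma root_refl_reflection:
  assumes "b \<in> pos_roots"
  shows "root_refl n b \<in> reflections (W_aff n) (simple_refls n)"
  using assms
proof (induction "nat (\<Sum>i<n. b i)" arbitrary: b rule: less_induct)
  case less
  have b: "b \<in> roots" "b \<in> Q_aff n" "0 \<le> b" "form n b b = 2"
    using less.prems by (auto simp: pos_roots_def roots_def)
  show ?case
  proof (cases "\<exists>i<n. b = simple_root i")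
    case True
    then have "root_refl n b \<in> simple_refls n"
      by (auto simp: simple_refls_eq)
    then have "root_refl n b = \<one>\<^bsub>W_aff n\<^esub> \<otimes>\<^bsub>W_aff n\<^esub> root_refl n b \<otimes>\<^bsub>W_aff n\<^esub> inv\<^bsub>W_aff n\<^esub> \<one>\<^bsub>W_aff n\<^esub>"
      by (simp add: simple_refl_in_W)
    then show ?thesis
      unfolding reflections_def using \<open>root_refl n b \<in> simple_refls n\<close> W.one_closed by blast
  next
    case False
    \<comment> \<open>The norm 2 of \<open>b\<close> is the sum of these products, so one of them is
      positive. As \<open>b i \<ge> 0\<close>, the pairing is then positive, and the reflection
      lowers the height by it.\<close>
    have "\<exists>i<n. b i * form n b (simple_root i) > 0"
    proof (rule ccontr)
      assume "\<not> ?thesis"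
      then have "(\<Sum>i<n. b i * form n b (simple_root i)) \<le> 0"
        by (intro sum_nonpos) (meson lessThan_iff not_less)
      then show False using form_simple_root_expand[of b] b(4) by simp
    qed
    then obtain i where i: "i < n" "b i * form n b (simple_root i) > 0"
      by blast
    have bi: "b i \<ge> 0" using b(3) by (simp add: le_fun_def)
    have k: "form n b (simple_root i) > 0"
      using i(2) bi by (simp add: zero_less_mult_iff)
    let ?r = "root_refl n (simple_root i)"
    define b' where "b' = ?r b"
    have r: "?r \<in> simple_refls n" "?r \<in> carrier (W_aff n)" "simple_root i \<in> roots"
      using i(1) simple_refl_in_W simple_root_pos pos_root_root by (auto simp: simple_refls_eq)
    have b': "b' \<in> pos_roots"
      unfolding b'_def using simple_refl_pos_root less.prems False i(1) by blast
    have "(\<Sum>j<n. simple_root i j) = 1"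
      using i(1) by (simp add: simple_root_def)
    then have "(\<Sum>j<n. b' j) = (\<Sum>j<n. b j) - form n b (simple_root i)"
      by (simp add: b'_def root_refl_apply[OF b(2)] sum.distrib sum_subtractf flip: sum_distrib_left)
    moreover have "(\<Sum>j<n. b' j) \<ge> 0"
      using b' by (intro sum_nonneg) (simp add: pos_roots_def le_fun_def)
    ultimately have "nat (\<Sum>j<n. b' j) < nat (\<Sum>j<n. b j)"
      using k by linarith
    then obtain x t where x: "x \<in> carrier (W_aff n)" "t \<in> simple_refls n"
      and eq: "root_refl n b' = x \<otimes>\<^bsub>W_aff n\<^esub> t \<otimes>\<^bsub>W_aff n\<^esub> inv\<^bsub>W_aff n\<^esub> x"
      using less.hyps[OF _ b'] unfolding reflections_def by blast
    have t: "t \<in> carrier (W_aff n)" using x(2) by (rule simple_refl_in_W)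
    have b'W: "root_refl n b' \<in> carrier (W_aff n)"
      unfolding eq using x(1) t by simp
    have "?r b' = b"
      unfolding b'_def by (rule root_refl_invol[OF r(3) b(2)])
    have "root_refl n b = ?r \<otimes>\<^bsub>W_aff n\<^esub> root_refl n b' \<otimes>\<^bsub>W_aff n\<^esub> ?r"
    proof (rule Bij_eqI)
      show "root_refl n b \<in> Bij (Q_aff n)" by (rule root_refl_Bij[OF b(1)])
      show "?r \<otimes>\<^bsub>W_aff n\<^esub> root_refl n b' \<otimes>\<^bsub>W_aff n\<^esub> ?r \<in> Bij (Q_aff n)"
        using r b'W by (intro W_Bij) simp
      fix y assume y: "y \<in> Q_aff n"
      have ry: "?r y \<in> Q_aff n" by (rule W_in_Q[OF r(2) y])
      have "(?r \<otimes>\<^bsub>W_aff n\<^esub> root_refl n b' \<otimes>\<^bsub>W_aff n\<^esub> ?r) y = ?r (root_refl n b' (?r y))"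
        by (simp only: W_mult_apply[OF W.m_closed[OF r(2) b'W] r(2) y] W_mult_apply[OF r(2) b'W ry])
      also have "\<dots> = root_refl n (?r b') (?r (?r y))"
        using root_refl_conj_apply[OF r(2) pos_root_root[OF b'] ry] by simp
      also have "\<dots> = root_refl n b y"
        by (simp only: \<open>?r b' = b\<close> root_refl_invol[OF r(3) y])
      finally show "root_refl n b y = (?r \<otimes>\<^bsub>W_aff n\<^esub> root_refl n b' \<otimes>\<^bsub>W_aff n\<^esub> ?r) y" ..
    qed
    also have "\<dots> = (?r \<otimes>\<^bsub>W_aff n\<^esub> x) \<otimes>\<^bsub>W_aff n\<^esub> t \<otimes>\<^bsub>W_aff n\<^esub> inv\<^bsub>W_aff n\<^esub> (?r \<otimes>\<^bsub>W_aff n\<^esub> x)"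
    proof -
      have "inv\<^bsub>W_aff n\<^esub> ?r = ?r"
        using simple_refl_invol[OF r(1)] r(2) by (simp add: W.inv_equality)
      then show ?thesis
        unfolding eq using x(1) t r(2) by (simp add: W.inv_mult_group W.m_assoc)
    qed
    finally show ?thesis
      unfolding reflections_def using x r(2) W.m_closed[OF r(2) x(1)] by blast
  qed
qed

lemma root_refl_in_W:
  assumes "b \<in> pos_roots"
  shows "root_refl n b \<in> carrier (W_aff n)"
proof -
  obtain x t where "x \<in> carrier (W_aff n)" "t \<in> simple_refls n"
    "root_refl n b = x \<otimes>\<^bsub>W_aff n\<^esub> t \<otimes>\<^bsub>W_aff n\<^esub> inv\<^bsub>W_aff n\<^esub> x"
    using root_refl_reflection[OF assms] unfolding reflections_def by blast
  then show ?thesis by (simp add: simple_refl_in_W)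
qed

lemma root_refl_square:
  assumes "b \<in> pos_roots"
  shows "root_refl n b \<otimes>\<^bsub>W_aff n\<^esub> root_refl n b = \<one>\<^bsub>W_aff n\<^esub>"
proof (rule Bij_eqI)
  fix x assume x: "x \<in> Q_aff n"
  show "(root_refl n b \<otimes>\<^bsub>W_aff n\<^esub> root_refl n b) x = \<one>\<^bsub>W_aff n\<^esub> x"
    using root_refl_invol[OF pos_root_root[OF assms] x]
    by (simp only: W_mult_apply[OF root_refl_in_W[OF assms] root_refl_in_W[OF assms] x] W_one_apply[OF x])
qed (use root_refl_in_W[OF assms] in \<open>simp_all add: W_Bij\<close>)

section \<open>Strong exchange and the Bruhat order\<close>

lemma root_refl_conj:
  assumes "g \<in> carrier (W_aff n)" "b \<in> pos_roots" "g b \<in> pos_roots"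
  shows "root_refl n (g b) \<otimes>\<^bsub>W_aff n\<^esub> g = g \<otimes>\<^bsub>W_aff n\<^esub> root_refl n b"
proof (rule Bij_eqI)
  note W = assms(1) root_refl_in_W[OF assms(2)] root_refl_in_W[OF assms(3)]
  fix x assume x: "x \<in> Q_aff n"
  show "(root_refl n (g b) \<otimes>\<^bsub>W_aff n\<^esub> g) x = (g \<otimes>\<^bsub>W_aff n\<^esub> root_refl n b) x"
    using root_refl_conj_apply[OF assms(1) pos_root_root[OF assms(2)] x]
    by (simp only: W_mult_apply[OF W(1,2) x] W_mult_apply[OF W(3,1) x])
qed (use assms root_refl_in_W in \<open>auto intro!: W_Bij\<close>)

text \<open>Strong exchange: apply the word to \<open>b\<close> letter by letter from the right. At
  some letter \<open>t\<close> a positive image turns non-positive, which a simple reflection does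
  only to its own simple root. Moved through the letters right of \<open>t\<close>, the reflection
  in \<open>b\<close> becomes a second copy of \<open>t\<close>, and the two cancel.\<close>

lemma word_exchange:
  assumes "set xs \<subseteq> simple_refls n" "b \<in> pos_roots" "word_prod xs b \<notin> pos_roots"
  shows "\<exists>ys. set ys \<subseteq> simple_refls n \<and> length ys < length xs \<and>
    word_prod xs \<otimes>\<^bsub>W_aff n\<^esub> root_refl n b = word_prod ys"
  using assms
proof (induction xs)
  case Nil
  then show ?case by (simp add: W_one_apply pos_root_in_Q)
next
  case (Cons t xs)
  let ?w = "word_prod xs"
  have W: "t \<in> carrier (W_aff n)" "?w \<in> carrier (W_aff n)" "root_refl n b \<in> carrier (W_aff n)"
    using Cons.prems by (auto simp: simple_refl_in_W word_prod_in_W root_refl_in_W)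
  show ?case
  proof (cases "?w b \<in> pos_roots")
    case False
    then obtain ys where ys: "set ys \<subseteq> simple_refls n" "length ys < length xs"
      "?w \<otimes>\<^bsub>W_aff n\<^esub> root_refl n b = word_prod ys"
      using Cons by auto
    have "word_prod (t # xs) \<otimes>\<^bsub>W_aff n\<^esub> root_refl n b = word_prod (t # ys)"
      using W by (simp add: W.m_assoc ys(3))
    then show ?thesis
      using ys(1,2) Cons.prems(1) by (intro exI[of _ "t # ys"]) simp
  next
    case True
    obtain i where i: "i < n" "t = root_refl n (simple_root i)"
      using Cons.prems(1) by (auto simp: simple_refls_eq)
    have "word_prod (t # xs) b = t (?w b)"
      using W_mult_apply[OF W(1,2) pos_root_in_Q[OF Cons.prems(2)]] by simp
    then have "t (?w b) \<notin> pos_roots" using Cons.prems(3) by metis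
    then have wb: "?w b = simple_root i"
      using simple_refl_pos_root[OF i(1) True] i(2) by blast
    have "?w \<otimes>\<^bsub>W_aff n\<^esub> root_refl n b = t \<otimes>\<^bsub>W_aff n\<^esub> ?w"
      using root_refl_conj[OF W(2) Cons.prems(2) True] unfolding wb i(2) by simp
    then have "word_prod (t # xs) \<otimes>\<^bsub>W_aff n\<^esub> root_refl n b = t \<otimes>\<^bsub>W_aff n\<^esub> (t \<otimes>\<^bsub>W_aff n\<^esub> ?w)"
      using W by (simp add: W.m_assoc)
    also have "\<dots> = ?w"
      using W simple_refl_invol[of t] Cons.prems(1) by (simp flip: W.m_assoc)
    finally show ?thesis
      using Cons.prems(1) by (intro exI[of _ xs]) simp
  qed
qed

lemma word_length_witness:
  assumes "g \<in> carrier (W_aff n)"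
  obtains xs where "set xs \<subseteq> simple_refls n" "length xs = word_length (W_aff n) (simple_refls n) g"
    "g = word_prod xs"
proof -
  let ?P = "\<lambda>k. \<exists>xs. set xs \<subseteq> simple_refls n \<and> length xs = k \<and> g = word_prod xs"
  have "\<exists>k. ?P k" using W_word[OF assms] by metis
  then have "?P (LEAST k. ?P k)" by (rule LeastI_ex)
  then show ?thesis using that unfolding word_length_def by blast
qed

lemma word_length_le:
  assumes "set xs \<subseteq> simple_refls n" "g = word_prod xs"
  shows "word_length (W_aff n) (simple_refls n) g \<le> length xs"
  unfolding word_length_def by (rule Least_le) (use assms in blast)

lemma bruhat_step_root_refl:
  assumes "g \<in> carrier (W_aff n)" "b \<in> pos_roots" "g b \<in> pos_roots"
  shows "bruhat_step (W_aff n) (simple_refls n) g (g \<otimes>\<^bsub>W_aff n\<^esub> root_refl n b)"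
proof -
  let ?v = "g \<otimes>\<^bsub>W_aff n\<^esub> root_refl n b"
  have r: "root_refl n b \<in> carrier (W_aff n)" by (rule root_refl_in_W[OF assms(2)])
  have v: "?v \<in> carrier (W_aff n)" using assms(1) r by simp
  obtain xs where xs: "set xs \<subseteq> simple_refls n"
    "length xs = word_length (W_aff n) (simple_refls n) ?v" "?v = word_prod xs"
    using word_length_witness[OF v] .
  have b: "b \<in> roots" "b \<in> Q_aff n"
    using assms(2) by (auto simp: pos_roots_def roots_def)
  \<comment> \<open>The exchange is applied to a shortest word of \<open>?v\<close>, which makes
    \<open>b\<close> negative. Multiplying \<open>?v\<close> by the reflection again gives back
    \<open>g\<close>, now as a shorter word.\<close>
  have "?v b = - g b"
    by (simp only: W_mult_apply[OF assms(1) r b(2)] root_refl_self[OF b(1)] W_uminus[OF assms(1) b(2)])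
  then have "word_prod xs b \<notin> pos_roots"
    using uminus_pos_root[OF assms(3)] xs(3) by metis
  then obtain ys where ys: "set ys \<subseteq> simple_refls n" "length ys < length xs"
    "word_prod xs \<otimes>\<^bsub>W_aff n\<^esub> root_refl n b = word_prod ys"
    using word_exchange[OF xs(1) assms(2)] by blast
  have "word_prod xs \<otimes>\<^bsub>W_aff n\<^esub> root_refl n b = g"
    unfolding xs(3)[symmetric] using assms(1) r root_refl_square[OF assms(2)] by (simp add: W.m_assoc)
  then have "word_length (W_aff n) (simple_refls n) g \<le> length ys"
    using word_length_le[OF ys(1)] ys(3) by simp
  then have "word_length (W_aff n) (simple_refls n) g < word_length (W_aff n) (simple_refls n) ?v"
    using ys(2) xs(2) by simp
  then show ?thesis
    unfolding bruhat_step_def using assms(1) v root_refl_reflection[OF assms(2)] by blast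
qed

lemma bruhat_le_root_refl:
  assumes "g \<in> carrier (W_aff n)" "b \<in> pos_roots" "g b \<in> pos_roots"
  shows "W_le n g (g \<otimes>\<^bsub>W_aff n\<^esub> root_refl n b)"
  using bruhat_step_root_refl[OF assms] assms(1) root_refl_in_W[OF assms(2)]
  by (simp add: bruhat_le_def r_into_rtranclp)

lemma bruhat_le_trans: "bruhat_le G S u v \<Longrightarrow> bruhat_le G S v w \<Longrightarrow> bruhat_le G S u w"
  unfolding bruhat_le_def by (metis rtranclp_trans)

text \<open>Every Bruhat step raises the length, so any nonempty succession of steps does.
  Antisymmetry and the minimality of the identity follow.\<close>

lemma bruhat_le_length:
  assumes "bruhat_le G S u v"
  shows "u = v \<or> word_length G S u < word_length G S v"
proof -
  have "(bruhat_step G S)\<^sup>*\<^sup>* u v" using assms by (simp add: bruhat_le_def)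
  then show ?thesis
    by induction (auto simp: bruhat_step_def)
qed

lemma bruhat_le_antisym: "bruhat_le G S u v \<Longrightarrow> bruhat_le G S v u \<Longrightarrow> u = v"
  using bruhat_le_length[of G S u v] bruhat_le_length[of G S v u] by auto

lemma bruhat_le_one:
  assumes "W_le n u \<one>\<^bsub>W_aff n\<^esub>"
  shows "u = \<one>\<^bsub>W_aff n\<^esub>"
  using bruhat_le_length[OF assms] word_length_le[of "[]" "\<one>\<^bsub>W_aff n\<^esub>"] by auto

section \<open>Products of reflections and the supports of their roots\<close>

definition refl_prod :: "(nat \<Rightarrow> int) list \<Rightarrow> (nat \<Rightarrow> int) \<Rightarrow> (nat \<Rightarrow> int)"
  where "refl_prod bs = foldr (\<lambda>b g. root_refl n b \<otimes>\<^bsub>W_aff n\<^esub> g) bs \<one>\<^bsub>W_aff n\<^esub>"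

lemma refl_prod_Nil [simp]: "refl_prod [] = \<one>\<^bsub>W_aff n\<^esub>"
  and refl_prod_Cons [simp]: "refl_prod (b # bs) = root_refl n b \<otimes>\<^bsub>W_aff n\<^esub> refl_prod bs"
  by (simp_all add: refl_prod_def)

lemma refl_prod_in_W: "set bs \<subseteq> pos_roots \<Longrightarrow> refl_prod bs \<in> carrier (W_aff n)"
  by (induction bs) (auto simp: root_refl_in_W)

lemma refl_prod_append:
  assumes "set bs \<subseteq> pos_roots" "set cs \<subseteq> pos_roots"
  shows "refl_prod (bs @ cs) = refl_prod bs \<otimes>\<^bsub>W_aff n\<^esub> refl_prod cs"
  using assms by (induction bs) (auto simp: root_refl_in_W refl_prod_in_W W.m_assoc)

lemma refl_prod_Cons_apply:
  assumes "b \<in> pos_roots" "set bs \<subseteq> pos_roots" "x \<in> Q_aff n"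
  shows "refl_prod (b # bs) x = root_refl n b (refl_prod bs x)"
  using W_mult_apply[OF root_refl_in_W[OF assms(1)] refl_prod_in_W[OF assms(2)] assms(3)] by simp

text \<open>A reflection in \<open>b\<close> adds a multiple of \<open>b\<close>, so it cannot alter
  a coefficient outside the support of \<open>b\<close>.\<close>

lemma refl_prod_coeff:
  assumes "set bs \<subseteq> pos_roots" "\<And>b. b \<in> set bs \<Longrightarrow> b i = 0" "x \<in> Q_aff n"
  shows "refl_prod bs x i = x i"
  using assms
proof (induction bs)
  case Nil
  then show ?case by (simp add: W_one_apply)
next
  case (Cons b bs)
  have bs: "b \<in> pos_roots" "set bs \<subseteq> pos_roots" using Cons.prems by auto
  have "refl_prod bs x \<in> Q_aff n"
    by (rule W_in_Q[OF refl_prod_in_W[OF bs(2)] Cons.prems(3)])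
  then have "refl_prod (b # bs) x i = refl_prod bs x i"
    using Cons.prems(2)[of b]
    by (simp only: refl_prod_Cons_apply[OF bs Cons.prems(3)] root_refl_apply plus_fun_apply) simp
  then show ?case using Cons by simp
qed

lemma refl_prod_fixes_orthogonal:
  assumes "set bs \<subseteq> pos_roots" "\<And>b. b \<in> set bs \<Longrightarrow> form n b x = 0" "x \<in> Q_aff n"
  shows "refl_prod bs x = x"
  using assms
proof (induction bs)
  case Nil
  then show ?case by (simp add: W_one_apply)
next
  case (Cons b bs)
  have bs: "b \<in> pos_roots" "set bs \<subseteq> pos_roots" using Cons.prems by auto
  have "refl_prod bs x = x" using Cons by simp
  moreover have "form n x b = 0" using Cons.prems(2)[of b] by (simp add: form_commute)
  ultimately show ?case
    by (simp only: refl_prod_Cons_apply[OF bs Cons.prems(3)] root_refl_apply[OF Cons.prems(3)])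
      (simp add: fun_eq_iff)
qed

lemma sum_list_pos_roots:
  assumes "set bs \<subseteq> pos_roots"
  shows "0 \<le> sum_list bs" "sum_list bs \<in> Q_aff n"
  using assms by (induction bs) (auto simp: pos_roots_def roots_def Q_aff_def le_fun_def)

text \<open>The summands are non-negative. Together with the bound 1 on total coefficients, this is
  how disjointness of supports is obtained.\<close>

lemma sum_list_pos_roots_zero:
  assumes "set bs \<subseteq> pos_roots" "sum_list bs i \<le> 0" "b \<in> set bs"
  shows "b i = 0"
  using assms
proof (induction bs)
  case (Cons a bs)
  have "0 \<le> sum_list bs" using sum_list_pos_roots(1)[of bs] Cons.prems(1) by simp
  then have "sum_list bs i \<ge> 0" by (simp add: le_fun_def)
  moreover have "a i \<ge> 0" using Cons.prems(1) by (simp add: pos_roots_def le_fun_def)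
  ultimately show ?case using Cons by auto
qed simp

section \<open>Roots below \<open>c\<close> and the merging of reflections\<close>

lemma sum_simple_root_apply:
  assumes "finite A"
  shows "(\<Sum>k\<in>A. simple_root k) i = (if i \<in> A then 1 else 0)"
  using assms by (induction A) (auto simp: simple_root_def)

lemma c_aff_apply: "c_aff n i = (if i < n then 1 else 0)"
  by (simp add: c_aff_def sum_simple_root_apply)

lemma less_c_aff_coeff_le_1:
  assumes "a < c_aff n"
  shows "a i \<le> 1"
proof -
  have "a i \<le> c_aff n i" using assms by (simp add: less_le le_fun_def)
  also have "\<dots> \<le> 1" by (simp add: c_aff_apply)
  finally show ?thesis .
qed

text \<open>An isotropic lattice vector is \<open>k\<close> times \<open>c\<close>; the bounds leave
  \<open>k = 0\<close> or \<open>k = 1\<close>, and strictness excludes the latter.\<close>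

lemma isotropic_less_c_aff_zero:
  assumes "x \<in> Q_aff n" "0 \<le> x" "x < c_aff n" "form n x x = 0"
  shows "x = 0"
proof -
  have le: "x \<le> c_aff n" "x \<noteq> c_aff n" using assms(3) by auto
  define k where "k = x 0"
  have x: "x i = (if i < n then k else 0)" for i
    using form_self_zero_const[OF assms(4), of i] assms(1) by (auto simp: Q_aff_def k_def)
  have "k \<noteq> 1"
  proof
    assume "k = 1"
    then have "x = c_aff n" by (intro ext) (simp add: x c_aff_apply)
    then show False using le(2) by simp
  qed
  moreover have "0 \<le> k" "k \<le> 1"
    using assms(2) less_c_aff_coeff_le_1[OF assms(3)] by (simp_all add: le_fun_def k_def)
  ultimately have "k = 0" by linarith
  then show ?thesis by (intro ext) (simp add: x)
qed

text \<open>At an index \<open>p\<close> in the support of \<open>g\<close> all roots of the list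
  vanish, so the product and its inverse both leave the coefficient at \<open>p\<close> alone; it
  stays positive and decides the sign.\<close>

lemma refl_prod_disjoint_pos:
  assumes "set bs \<subseteq> pos_roots" "g \<in> pos_roots" "\<And>b i. b \<in> set bs \<Longrightarrow> g i > 0 \<Longrightarrow> b i = 0"
  shows "refl_prod bs g \<in> pos_roots" "(inv\<^bsub>W_aff n\<^esub> refl_prod bs) g \<in> pos_roots"
proof -
  let ?w = "refl_prod bs"
  let ?v = "inv\<^bsub>W_aff n\<^esub> ?w"
  have W: "?w \<in> carrier (W_aff n)" "?v \<in> carrier (W_aff n)"
    using refl_prod_in_W[OF assms(1)] by simp_all
  obtain p where p: "g p > 0" using pos_root_ex_pos[OF assms(2)] by blast
  have g: "g \<in> roots" "g \<in> Q_aff n" using assms(2) by (auto simp: pos_roots_def roots_def)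
  have fix_p: "?w x p = x p" if "x \<in> Q_aff n" for x
    using refl_prod_coeff[OF assms(1) _ that] assms(3) p by simp
  have "?w g p > 0" using fix_p[OF g(2)] p by simp
  then show "?w g \<in> pos_roots" by (rule root_pos_coeff[OF W_root[OF W(1) g(1)]])
  \<comment> \<open>For the inverse, \<open>fix_p\<close> is applied to \<open>?v g\<close>, whose
    image under \<open>?w\<close> is \<open>g\<close>.\<close>
  have "?w (?v g) = g"
    using W_mult_apply[OF W g(2)] W.r_inv[OF W(1)] W_one_apply[OF g(2)] by simp
  then have "?v g p > 0"
    using fix_p[OF W_in_Q[OF W(2) g(2)]] p by simp
  then show "?v g \<in> pos_roots" by (rule root_pos_coeff[OF W_root[OF W(2) g(1)]])
qed

text \<open>Coefficients of \<open>b + g\<close> are at most 1, so the supports are disjoint and the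
  pairing is at most 0. The norm of \<open>b + g\<close> is 4 plus twice the pairing; it is
  positive, as a nonzero non-negative vector below \<open>c\<close> is not isotropic. So a nonzero
  pairing is -1, and the norm is 2.\<close>

lemma adjacent_roots:
  assumes "b \<in> pos_roots" "g \<in> pos_roots" "b + g \<le> a" "a < c_aff n" "form n b g \<noteq> 0"
  shows "form n b g = - 1" "b + g \<in> pos_roots"
proof -
  have b: "b \<in> Q_aff n" "0 \<le> b" "form n b b = 2" and g: "g \<in> Q_aff n" "0 \<le> g" "form n g g = 2"
    using assms by (auto simp: pos_roots_def roots_def)
  have "b i * g i = 0" for i
  proof -
    have "b i + g i \<le> 1"
      using assms(3) less_c_aff_coeff_le_1[OF assms(4), of i] by (auto simp: le_fun_def intro: order_trans)
    moreover have "0 \<le> b i" "0 \<le> g i" using b g by (simp_all add: le_fun_def)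
    ultimately have "b i = 0 \<or> g i = 0" by linarith
    then show ?thesis by simp
  qed
  then have "form n b g \<le> 0" using form_nonpos_disjoint b(2) g(2) by blast
  have eq: "form n (b + g) (b + g) = 4 + 2 * form n b g"
    using b g form_commute[of g b] by (simp add: form_add_left form_add_right)
  have sum: "b + g \<in> Q_aff n" "0 \<le> b + g"
    using b g by (auto simp: Q_add le_fun_def)
  have "form n (b + g) (b + g) \<noteq> 0"
  proof
    assume "form n (b + g) (b + g) = 0"
    moreover have "b + g < c_aff n" using assms(3,4) by simp
    ultimately have "b + g = 0" using isotropic_less_c_aff_zero sum by blast
    moreover obtain p where "b p > 0" using pos_root_ex_pos[OF assms(1)] by blast
    moreover have "g p \<ge> 0" using g by (simp add: le_fun_def)
    ultimately show False using plus_fun_apply[of b g p] by simp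
  qed
  then have "form n (b + g) (b + g) > 0" using form_self_nonneg[of "b + g"] by simp
  then show *: "form n b g = - 1"
    using eq \<open>form n b g \<le> 0\<close> assms(5) by linarith
  show "b + g \<in> pos_roots"
    using sum eq * by (simp add: pos_roots_def roots_def)
qed

text \<open>
  The reflections in \<open>M\<close> commute with the one in \<open>g\<close>, and the two sides differ by the
  reflection in the positive root \<open>d\<close> with \<open>refl_prod M d = b\<close>. The left-hand side sends \<open>d\<close> to
  \<open>refl_prod U g\<close>, which is positive as the supports are disjoint; so the length increases.
\<close>

lemma refl_prod_merge:
  assumes "set (U @ b # M @ [g]) \<subseteq> pos_roots" "sum_list (U @ b # M @ [g]) \<le> a" "a < c_aff n"
    and "form n b g \<noteq> 0" "\<And>m. m \<in> set M \<Longrightarrow> form n m g = 0"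
  shows "b + g \<in> pos_roots" "W_le n (refl_prod (U @ b # M @ [g])) (refl_prod (U @ (b + g) # M))"
proof -
  have pos: "set U \<subseteq> pos_roots" "set M \<subseteq> pos_roots" "b \<in> pos_roots" "g \<in> pos_roots"
    using assms(1) by auto
  have bg: "b \<in> Q_aff n" "0 \<le> b" "form n b b = 2" "g \<in> Q_aff n" "0 \<le> g" "form n g g = 2"
    using pos by (auto simp: pos_roots_def roots_def)
  have nonneg: "0 \<le> sum_list U i" "0 \<le> sum_list M i" "0 \<le> b i" "0 \<le> g i" for i
    using sum_list_pos_roots(1)[OF pos(1)] sum_list_pos_roots(1)[OF pos(2)] bg(2,5)
    by (simp_all add: le_fun_def)
  have sum: "sum_list U i + (b i + (sum_list M i + g i)) \<le> a i" for i
    using assms(2) by (simp add: le_fun_def add.assoc)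
  have sum1: "sum_list U i + (b i + (sum_list M i + g i)) \<le> 1" for i
    using sum[of i] less_c_aff_coeff_le_1[OF assms(3), of i] by linarith
  have "b + g \<le> a"
  proof (rule le_funI)
    show "(b + g) i \<le> a i" for i
      using sum[of i] nonneg[of i] by simp
  qed
  note adj = adjacent_roots[OF pos(3,4) this assms(3,4)]
  show sum_pos: "b + g \<in> pos_roots" by (rule adj(2))
  \<comment> \<open>Where \<open>g\<close> is positive it uses up the bound 1 on the total
    coefficient, so nothing is left for the roots in \<open>U\<close>; likewise for \<open>b\<close>
    and \<open>M\<close>.\<close>
  have U0: "u i = 0" if "u \<in> set U" "g i > 0" for u i
    by (rule sum_list_pos_roots_zero[OF pos(1) _ that(1)]) (use sum1[of i] nonneg[of i] that in linarith)
  have M0: "m i = 0" if "m \<in> set M" "b i > 0" for m i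
    by (rule sum_list_pos_roots_zero[OF pos(2) _ that(1)]) (use sum1[of i] nonneg[of i] that in linarith)
  let ?sb = "root_refl n b" and ?sg = "root_refl n g" and ?u = "refl_prod U" and ?m = "refl_prod M"
  have W: "?sb \<in> carrier (W_aff n)" "?sg \<in> carrier (W_aff n)" "?u \<in> carrier (W_aff n)" "?m \<in> carrier (W_aff n)"
    using pos root_refl_in_W refl_prod_in_W by auto
  define d where "d = (inv\<^bsub>W_aff n\<^esub> ?m) b"
  have d: "d \<in> pos_roots"
    unfolding d_def by (rule refl_prod_disjoint_pos(2)[OF pos(2,3)]) (rule M0)
  have dQ: "d \<in> Q_aff n" by (rule pos_root_in_Q[OF d])
  have md: "?m d = b"
    unfolding d_def
    using W_mult_apply[OF W(4) W.inv_closed[OF W(4)] bg(1)] W.r_inv[OF W(4)] W_one_apply[OF bg(1)] by simp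
  have sd: "root_refl n d \<in> carrier (W_aff n)" by (rule root_refl_in_W[OF d])
  have mg: "?m g = g"
    by (rule refl_prod_fixes_orthogonal[OF pos(2) assms(5) bg(4)])
  have comm: "?m \<otimes>\<^bsub>W_aff n\<^esub> ?sg = ?sg \<otimes>\<^bsub>W_aff n\<^esub> ?m"
    using root_refl_conj[OF W(4) pos(4)] pos(4) unfolding mg by simp
  have conj_d: "?m \<otimes>\<^bsub>W_aff n\<^esub> root_refl n d = ?sb \<otimes>\<^bsub>W_aff n\<^esub> ?m"
    using root_refl_conj[OF W(4) d] pos(3) unfolding md by simp
  have "?sb g = b + g" and sgb: "?sg b = b + g"
    using root_refl_apply[OF bg(4), of b] root_refl_apply[OF bg(1), of g] adj(1) form_commute[of g b]
    by (simp_all add: fun_eq_iff)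
  \<comment> \<open>As \<open>?sb g = b + g\<close>, the reflection in \<open>b + g\<close> is the
    conjugate by \<open>?sb\<close> of the one in \<open>g\<close>.\<close>
  then have conj_g: "root_refl n (b + g) \<otimes>\<^bsub>W_aff n\<^esub> ?sb = ?sb \<otimes>\<^bsub>W_aff n\<^esub> ?sg"
    using root_refl_conj[OF W(1) pos(4)] sum_pos by simp
  let ?v = "refl_prod (U @ b # M @ [g])"
  have v: "?v = ?u \<otimes>\<^bsub>W_aff n\<^esub> (?sb \<otimes>\<^bsub>W_aff n\<^esub> (?sg \<otimes>\<^bsub>W_aff n\<^esub> ?m))"
    using pos W by (simp add: refl_prod_append comm)
  have vW: "?v \<in> carrier (W_aff n)"
    by (rule refl_prod_in_W[OF assms(1)])
  \<comment> \<open>To the right of \<open>?u\<close> the product becomes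
    \<open>s_b s_g s_b m = s_(b+g) s_b s_b m = s_(b+g) m\<close>, with \<open>m\<close> for
    \<open>?m\<close>.\<close>
  have "?v \<otimes>\<^bsub>W_aff n\<^esub> root_refl n d =
      ?u \<otimes>\<^bsub>W_aff n\<^esub> (?sb \<otimes>\<^bsub>W_aff n\<^esub> ?sg \<otimes>\<^bsub>W_aff n\<^esub> (?m \<otimes>\<^bsub>W_aff n\<^esub> root_refl n d))"
    unfolding v using W sd by (simp add: W.m_assoc)
  also have "\<dots> = ?u \<otimes>\<^bsub>W_aff n\<^esub> (root_refl n (b + g) \<otimes>\<^bsub>W_aff n\<^esub> ((?sb \<otimes>\<^bsub>W_aff n\<^esub> ?sb) \<otimes>\<^bsub>W_aff n\<^esub> ?m))"
    unfolding conj_d conj_g[symmetric] using W root_refl_in_W[OF sum_pos] by (simp add: W.m_assoc)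
  also have "\<dots> = refl_prod (U @ (b + g) # M)"
    using pos sum_pos W root_refl_square[OF pos(3)] by (simp add: refl_prod_append)
  finally have target: "?v \<otimes>\<^bsub>W_aff n\<^esub> root_refl n d = refl_prod (U @ (b + g) # M)" .
  have "?sb (b + g) = - b + (b + g)"
    using root_refl_add[OF bg(1,4), of b] root_refl_self[OF pos_root_root[OF pos(3)]] \<open>?sb g = b + g\<close> by simp
  then have sbg: "?sb (b + g) = g" by simp
  have bgQ: "b + g \<in> Q_aff n" by (rule pos_root_in_Q[OF sum_pos])
  have "?v d = ?u (?sb (?sg (?m d)))"
    unfolding v
    by (simp only: W_mult_apply[OF W(3) W.m_closed[OF W(1) W.m_closed[OF W(2,4)]] dQ]
        W_mult_apply[OF W(1) W.m_closed[OF W(2,4)] dQ] W_mult_apply[OF W(2,4) dQ])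
  also have "\<dots> = ?u g" by (simp only: md sgb sbg)
  also have "?u g \<in> pos_roots"
    by (rule refl_prod_disjoint_pos(1)[OF pos(1,4)]) (rule U0)
  finally have "?v d \<in> pos_roots" .
  then show "W_le n ?v (refl_prod (U @ (b + g) # M))"
    using bruhat_le_root_refl[OF vW d] unfolding target by blast
qed

lemma ex_not_orthogonal:
  assumes "a \<in> pos_roots" "a < c_aff n" "set L \<subseteq> pos_roots" "g \<in> pos_roots"
    "sum_list (L @ [g]) = a" "L \<noteq> []"
  shows "\<exists>b\<in>set L. form n b g \<noteq> 0"
proof (rule ccontr)
  assume *: "\<not> ?thesis"
  then have "\<forall>b\<in>set L. form n b g = 0" by blast
  then have "form n (sum_list L) g = 0"
    by (induction L) (auto simp: form_add_left)
  moreover have a: "a = sum_list L + g" using assms(5) by simp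
  moreover have "form n a a = 2" "form n g g = 2" using assms(1,4) by (auto simp: pos_roots_def roots_def)
  \<comment> \<open>By orthogonality the norms add: 2 is the norm of \<open>sum_list L\<close> plus
    2.\<close>
  ultimately have "form n (sum_list L) (sum_list L) = 0"
    using form_commute[of g "sum_list L"] by (simp add: form_add_left form_add_right)
  moreover have "sum_list L \<le> a"
    using assms(4) by (simp add: a pos_roots_def le_fun_def)
  then have "sum_list L < c_aff n" using assms(2) by simp
  ultimately have "sum_list L = 0"
    using isotropic_less_c_aff_zero sum_list_pos_roots[OF assms(3)] by blast
  then have "hd L i = 0" for i
    using sum_list_pos_roots_zero[OF assms(3), of i "hd L"] assms(6) by simp
  moreover have "hd L \<in> pos_roots" using assms(3,6) by auto
  ultimately show False using pos_root_ex_pos[of "hd L"] by auto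
qed

text \<open>Induction on the number of factors: a merge keeps the sum, drops one factor and goes up
  in Bruhat order, and a single remaining factor can only be \<open>a\<close>.\<close>

lemma refl_prod_le_of_sum_eq:
  assumes "a \<in> pos_roots" "a < c_aff n" "set bs \<subseteq> pos_roots" "sum_list bs = a"
  shows "W_le n (refl_prod bs) (root_refl n a)"
  using assms(3,4)
proof (induction "length bs" arbitrary: bs rule: less_induct)
  case less
  have "a \<noteq> 0" using assms(1) by (auto simp: pos_roots_def roots_def)
  then have "bs \<noteq> []" using less.prems by auto
  then obtain L g where bs: "bs = L @ [g]" by (metis rev_exhaust)
  show ?case
  proof (cases "L = []")
    case True
    then have "refl_prod bs = root_refl n a"
      using less.prems bs root_refl_in_W[OF assms(1)] by simp
    then show ?thesis
      using root_refl_in_W[OF assms(1)] by (simp add: bruhat_le_def)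
  next
    case False
    have "\<exists>b\<in>set L. form n b g \<noteq> 0"
      by (rule ex_not_orthogonal[OF assms(1,2)]) (use less.prems bs False in auto)
    \<comment> \<open>Choosing the last such \<open>b\<close> makes every root of \<open>M\<close>
      orthogonal to \<open>g\<close>, as the merge requires.\<close>
    then obtain U b M where L: "L = U @ b # M" "form n b g \<noteq> 0" "\<forall>m\<in>set M. \<not> form n m g \<noteq> 0"
      using split_list_last_prop[of L "\<lambda>b. form n b g \<noteq> 0"] by blast
    have bs': "bs = U @ b # M @ [g]" using bs L by simp
    note merge = refl_prod_merge[of U b M g a]
    have m: "b + g \<in> pos_roots" "W_le n (refl_prod bs) (refl_prod (U @ (b + g) # M))"
      using merge less.prems assms(2) L(2,3) unfolding bs' by auto
    have "W_le n (refl_prod (U @ (b + g) # M)) (root_refl n a)"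
    proof (rule less.hyps)
      show "length (U @ (b + g) # M) < length bs" by (simp add: bs')
      show "set (U @ (b + g) # M) \<subseteq> pos_roots" using less.prems(1) m(1) by (auto simp: bs')
      show "sum_list (U @ (b + g) # M) = a" using less.prems(2) by (simp add: bs' ac_simps)
    qed
    then show ?thesis by (rule bruhat_le_trans[OF m(2)])
  qed
qed

text \<open>Induction on the height of \<open>a - sum_list bs\<close>. Where the sum falls short of
  \<open>a\<close>, the simple root is disjoint from the list, so appending its reflection goes up
  in Bruhat order.\<close>

lemma refl_prod_le:
  assumes "a \<in> pos_roots" "a < c_aff n" "set bs \<subseteq> pos_roots" "sum_list bs \<le> a"
  shows "W_le n (refl_prod bs) (root_refl n a)"
  using assms(3,4)
proof (induction "nat (\<Sum>i<n. a i - sum_list bs i)" arbitrary: bs rule: less_induct)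
  case less
  show ?case
  proof (cases "sum_list bs = a")
    case True
    then show ?thesis using refl_prod_le_of_sum_eq[OF assms(1,2)] less.prems by blast
  next
    case False
    then obtain i where "sum_list bs i \<noteq> a i" by (auto simp: fun_eq_iff)
    moreover have le: "sum_list bs j \<le> a j" for j using less.prems(2) by (simp add: le_fun_def)
    ultimately have i: "sum_list bs i < a i" by (simp add: less_le)
    have nonneg: "sum_list bs i \<ge> 0"
      using sum_list_pos_roots(1)[OF less.prems(1)] by (simp add: le_fun_def)
    \<comment> \<open>This coefficient is a non-negative integer strictly below one that is at most
      1.\<close>
    then have bs0: "sum_list bs i = 0"
      using i less_c_aff_coeff_le_1[OF assms(2), of i] by linarith
    have "i < n"
      using pos_root_in_Q[OF assms(1)] i nonneg by (force simp: Q_aff_def not_less[symmetric])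
    let ?e = "simple_root i"
    have e: "?e \<in> pos_roots" "?e \<in> Q_aff n"
      using simple_root_pos[OF \<open>i < n\<close>] pos_root_in_Q by auto
    have prems: "set (bs @ [?e]) \<subseteq> pos_roots" using less.prems(1) e(1) by simp
    have "sum_list (bs @ [?e]) \<le> a"
    proof (rule le_funI)
      fix j
      show "sum_list (bs @ [?e]) j \<le> a j"
        using le[of j] i by (simp add: simple_root_def)
    qed
    moreover have "nat (\<Sum>j<n. a j - sum_list (bs @ [?e]) j) < nat (\<Sum>j<n. a j - sum_list bs j)"
    proof -
      have "(\<Sum>j<n. ?e j) = 1" using \<open>i < n\<close> by (simp add: simple_root_def)
      then have "(\<Sum>j<n. a j - sum_list (bs @ [?e]) j) = (\<Sum>j<n. a j - sum_list bs j) - 1"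
        by (simp add: sum_subtractf sum.distrib)
      moreover have "(\<Sum>j<n. a j - sum_list (bs @ [?e]) j) \<ge> 0"
        using calculation \<open>sum_list (bs @ [?e]) \<le> a\<close> by (intro sum_nonneg) (simp add: le_fun_def)
      ultimately show ?thesis by linarith
    qed
    ultimately have le_a: "W_le n (refl_prod (bs @ [?e])) (root_refl n a)"
      using less.hyps[of "bs @ [?e]"] prems by blast
    have snoc: "refl_prod (bs @ [?e]) = refl_prod bs \<otimes>\<^bsub>W_aff n\<^esub> root_refl n ?e"
      using less.prems(1) e(1) root_refl_in_W[OF e(1)] by (simp add: refl_prod_append)
    have "refl_prod bs ?e \<in> pos_roots"
    proof (rule refl_prod_disjoint_pos(1)[OF less.prems(1) e(1)])
      fix b j assume "b \<in> set bs" "?e j > 0"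
      then show "b j = 0"
        using sum_list_pos_roots_zero[OF less.prems(1), of i b] bs0
        by (simp add: simple_root_def split: if_splits)
    qed
    then have "W_le n (refl_prod bs) (refl_prod bs \<otimes>\<^bsub>W_aff n\<^esub> root_refl n ?e)"
      by (rule bruhat_le_root_refl[OF refl_prod_in_W[OF less.prems(1)] e(1)])
    then show ?thesis
      using le_a unfolding snoc by (rule bruhat_le_trans)
  qed
qed

section \<open>Positive real roots and chains in terms of norm 2 vectors\<close>

lemma fin_pos_roots_pos:
  assumes "a \<in> fin_pos_roots n"
  shows "a \<in> pos_roots" "a i \<le> 1"
proof -
  obtain p q where pq: "1 \<le> p" "p \<le> q" "q < n" and a_def: "a = (\<Sum>k=p..q. simple_root k)"
    using assms unfolding fin_pos_roots_def by blast
  have a: "a i = (if p \<le> i \<and> i \<le> q then 1 else 0)" for i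
    by (simp add: a_def sum_simple_root_apply)
  \<comment> \<open>The indicator of \<open>p..q\<close> jumps only on entering at \<open>p\<close>
    and on leaving after \<open>q\<close>. As \<open>1 \<le> p\<close>, index 0 lies outside, so the
    second jump also occurs when \<open>q = n - 1\<close> and the cycle wraps around.\<close>
  have "diff a i * diff a i = (if i = p - 1 then 1 else 0) + (if i = q then 1 else 0)" if "i < n" for i
    using that pq by (cases "Suc i = n") (auto simp: diff_def a)
  then have "form n a a = (\<Sum>i<n. (if i = p - 1 then 1 else 0) + (if i = q then 1 else 0))"
    unfolding form_diff by (intro sum.cong) auto
  then have "form n a a = 2"
    using pq by (simp add: sum.distrib)
  then show "a \<in> pos_roots"
    using pq by (simp add: pos_roots_def roots_def Q_aff_def le_fun_def a)
  show "a i \<le> 1" by (simp add: a)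
qed

text \<open>Adding a multiple of \<open>c\<close> leaves the cyclic differences, and so the norm,
  unchanged. Finite roots have coefficients at least -1, which \<open>m \<ge> 1\<close> copies of
  \<open>c\<close> make non-negative.\<close>

lemma pos_real_roots_subset: "pos_real_roots n \<subseteq> pos_roots"
proof
  fix x assume "x \<in> pos_real_roots n"
  then obtain a m where x: "x = a + (\<lambda>i. m * c_aff n i)" and a: "a \<in> fin_roots n"
    and m: "m > 0 \<or> m = 0 \<and> a \<in> fin_pos_roots n"
    unfolding pos_real_roots_def by blast
  show "x \<in> pos_roots"
  proof (cases "m = 0")
    case True
    then have "x = a" using x by (simp add: fun_eq_iff)
    then show ?thesis using True m fin_pos_roots_pos by simp
  next
    case False
    have a2: "a \<in> roots" "\<And>i. a i \<ge> - 1"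
    proof -
      obtain b where b: "b \<in> fin_pos_roots n" "a = b \<or> a = - b"
        using a unfolding fin_roots_def by blast
      have br: "b \<in> roots" "0 \<le> b" using fin_pos_roots_pos(1)[OF b(1)] by (auto simp: pos_roots_def)
      have "form n (- b) (- b) = form n b b"
        using form_commute[of b "- b"] by (simp add: form_uminus_left)
      then show "a \<in> roots" using br b(2) by (auto simp: roots_def Q_aff_def)
      show "a i \<ge> - 1" for i
        using b(2) fin_pos_roots_pos(2)[OF b(1), of i] br(2) by (auto simp: le_fun_def intro: order_trans[of _ 0])
    qed
    have "diff x i = diff a i" if "i < n" for i
      using that n_ge_3 by (simp add: x diff_def c_aff_apply)
    then have "form n x x = form n a a"
      by (simp add: form_diff)
    moreover have "x \<in> Q_aff n"
      using root_in_Q[OF a2(1)] by (simp add: x Q_aff_def c_aff_apply)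
    moreover have "x i \<ge> 0" for i
    proof (cases "i < n")
      case True
      have "a i \<ge> - 1" by (rule a2(2))
      then show ?thesis using m False True by (simp add: x c_aff_apply)
    next
      case False
      then show ?thesis using \<open>x \<in> Q_aff n\<close> by (simp add: Q_aff_def)
    qed
    ultimately show ?thesis using a2(1) by (simp add: pos_roots_def roots_def le_fun_def)
  qed
qed

text \<open>Each edge multiplies by a reflection on the right, so the degrees along the chain list
  the factors in order.\<close>

lemma mg_chain_one:
  assumes "mg_chain n \<one>\<^bsub>W_aff n\<^esub> v d"
  shows "\<exists>bs. set bs \<subseteq> pos_roots \<and> v = refl_prod bs \<and> d = sum_list bs"
  using assms
proof induction
  case empty
  show ?case by (rule exI[of _ "[]"]) simp
next
  case (step v d a)
  from step.IH obtain bs where bs: "set bs \<subseteq> pos_roots" "v = refl_prod bs" "d = sum_list bs"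
    by (elim exE conjE)
  have a: "a \<in> pos_roots" by (rule subsetD[OF pos_real_roots_subset step.hyps(2)])
  show ?case
    using bs a root_refl_in_W[OF a] by (intro exI[of _ "bs @ [a]"]) (simp add: refl_prod_append)
qed

text \<open>Only the identity lies below the identity, so all chains start there and
  \<open>refl_prod_le\<close> bounds their ends.\<close>

lemma reachable_one_le:
  assumes "a \<in> pos_roots" "a < c_aff n" "v \<in> reachable n a \<one>\<^bsub>W_aff n\<^esub>"
  shows "W_le n v (root_refl n a)"
proof -
  obtain d where "mg_chain n \<one>\<^bsub>W_aff n\<^esub> v d" "d \<le> a"
    using assms(3) bruhat_le_one unfolding reachable_def by blast
  then show ?thesis
    using mg_chain_one[of v d] refl_prod_le[OF assms(1,2)] by blast
qed

lemma root_refl_reachable: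
  assumes "a \<in> pos_real_roots n"
  shows "root_refl n a \<in> reachable n a \<one>\<^bsub>W_aff n\<^esub>"
proof -
  have W: "root_refl n a \<in> carrier (W_aff n)"
    using assms pos_real_roots_subset root_refl_in_W by blast
  have "mg_chain n \<one>\<^bsub>W_aff n\<^esub> (\<one>\<^bsub>W_aff n\<^esub> \<otimes>\<^bsub>W_aff n\<^esub> root_refl n a) (0 + a)"
    by (intro mg_chain.intros assms W.one_closed)
  then have "mg_chain n \<one>\<^bsub>W_aff n\<^esub> (root_refl n a) a" using W by simp
  moreover have "W_le n \<one>\<^bsub>W_aff n\<^esub> \<one>\<^bsub>W_aff n\<^esub>" by (simp add: bruhat_le_def)
  ultimately show ?thesis unfolding reachable_def using W by blast
qed

end

theorem theorem5p3:
  fixes n :: nat and \<alpha> :: "nat \<Rightarrow> int"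
  assumes "n \<ge> 3"
    and "\<alpha> \<in> pos_real_roots n"
    and "\<alpha> < c_aff n"
  shows "curve_nbhd n \<alpha> \<one>\<^bsub>W_aff n\<^esub> = {root_refl n \<alpha>}"
proof -
  interpret affine_type_A n by unfold_locales (rule assms(1))
  have pos: "\<alpha> \<in> pos_roots" using assms(2) pos_real_roots_subset by blast
  let ?R = "reachable n \<alpha> \<one>\<^bsub>W_aff n\<^esub>" and ?s = "root_refl n \<alpha>"
  have s: "?s \<in> ?R" by (rule root_refl_reachable[OF assms(2)])
  \<comment> \<open>Thus \<open>?s\<close> is the greatest element of the reachable set; by
    antisymmetry it is the only maximal one.\<close>
  have le: "W_le n v ?s" if "v \<in> ?R" for v
    by (rule reachable_one_le[OF pos assms(3) that])
  show ?thesis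
  proof (intro equalityI subsetI)
    fix v assume "v \<in> curve_nbhd n \<alpha> \<one>\<^bsub>W_aff n\<^esub>"
    then have "v \<in> ?R" "W_le n v ?s \<longrightarrow> ?s = v" using s by (auto simp: curve_nbhd_def)
    then show "v \<in> {?s}" using le by simp
  next
    fix v assume "v \<in> {?s}"
    moreover have "w = ?s" if "w \<in> ?R" "W_le n ?s w" for w
      using bruhat_le_antisym[OF le[OF that(1)] that(2)] .
    ultimately show "v \<in> curve_nbhd n \<alpha> \<one>\<^bsub>W_aff n\<^esub>"
      using s by (simp add: curve_nbhd_def)
  qed
qed

end
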